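(* Let $d\ge 1$, $\gamma\in\mathbb{R}\setminus\{0\}$ and $b\in\mathbb R$, and let $Z$ be the interacting branching diffusion in $\mathbb{R}^d$ with drift parameter $b$ and interaction parameter $\gamma$, with center of mass $\overline{Z_t}$. If $b>0$, then $\lim_{t\to\infty}\overline{Z_t}=0$ almost surely.
   Context: Model. Fix $d\ge1$, $b\in\mathbb{R}$ and $\gamma\neq 0$. The process $Z$ starts at time $0$ with one particle at the origin of $\mathbb{R}^d$. For each $m=0,1,2,\dots$, during the time interval $[m,m+1)$ there are exactly $2^m$ particles, with positions $Z_t^i$, $1\le i\le 2^m$; at each integer time $m\ge 1$ every particle is replaced by exactly two offspring, located at the parent's position (labels are arbitrary but independent of the spatial motion). On $[m,m+1)$ the positions satisfy $$\mathrm{d}Z_t^i = \mathrm{d}W_t^{i,m} - bZ_t^i\,\mathrm{d}t + \frac{1}{2^m}\sum_{j=1}^{2^m}\gamma\,(Z_t^j-Z_t^i)\,\mathrm{d}t,\qquad 1\le i\le 2^m,$$ where $\{W^{i,m}\}_{1\le i\le 2^m}$ are independent standard $d$-dimensional Brownian motions on $[m,m+1)$, also independent of the past up to time $m$. Center of mass: for $t\in[m,m+1)$, $\overline{Z_t}:=2^{-m}\sum_{i=1}^{2^m}Z_t^i$. *)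

theory Defs
  imports "HOL-Probability.Probability"
begin

text \<open>The sigma-algebra generated by the family \<open>X i\<close>, \<open>i \<in> I\<close>, of \<open>N\<close>-valued random variables.\<close>

definition generated_events ::
  "'w measure \<Rightarrow> 'b measure \<Rightarrow> ('i \<Rightarrow> 'w \<Rightarrow> 'b) \<Rightarrow> 'i set \<Rightarrow> 'w set set" where
  "generated_events M N X I =
     sigma_sets (space M) (\<Union>i\<in>I. {X i -` A \<inter> space M | A. A \<in> sets N})"

text \<open>Standard Brownian motion in \<open>d\<close> dimensions, \<open>d = CARD('d) \<ge> 1\<close>, on the half-open
  interval \<open>[a, b)\<close>, started from \<open>0\<close> at time \<open>a\<close>. The increment over \<open>[s, t]\<close> has the
  centred normal distribution with covariance matrix \<open>t - s\<close> times the identity, given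
  here by its density; the second argument of \<^const>\<open>normal_density\<close> is a standard deviation.\<close>

definition (in prob_space) standard_Brownian_motion_on ::
  "real \<Rightarrow> real \<Rightarrow> (real \<Rightarrow> 'a \<Rightarrow> real ^ 'd) \<Rightarrow> bool" where
  "standard_Brownian_motion_on a b W \<longleftrightarrow>
     (\<forall>t\<in>{a..<b}. W t \<in> borel_measurable M) \<and>
     (AE w in M. W a w = 0) \<and>
     (AE w in M. continuous_on {a..<b} (\<lambda>t. W t w)) \<and>
     (\<forall>n (\<tau> :: nat \<Rightarrow> real).
        (\<forall>k\<le>n. \<tau> k \<in> {a..<b}) \<longrightarrow> (\<forall>k<n. \<tau> k \<le> \<tau> (Suc k)) \<longrightarrow>
        indep_vars (\<lambda>_. borel) (\<lambda>k w. W (\<tau> (Suc k)) w - W (\<tau> k) w) {..<n}) \<and>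
     (\<forall>s t. a \<le> s \<longrightarrow> s < t \<longrightarrow> t < b \<longrightarrow>
        distributed M lborel (\<lambda>w. W t w - W s w)
          (\<lambda>x. ennreal (\<Prod>k\<in>UNIV. normal_density 0 (sqrt (t - s)) (x $ k))))"

text \<open>The drift of particle \<open>i\<close> when the \<open>2 ^ m\<close> particles are in configuration \<open>x\<close>.\<close>

definition interaction_drift ::
  "real \<Rightarrow> real \<Rightarrow> nat \<Rightarrow> (nat \<Rightarrow> real ^ 'd) \<Rightarrow> nat \<Rightarrow> real ^ 'd" where
  "interaction_drift b \<gamma> m x i =
     - b *\<^sub>R x i + (1 / 2 ^ m) *\<^sub>R (\<Sum>j\<in>{1..2 ^ m}. \<gamma> *\<^sub>R (x j - x i))"

definition center_of_mass :: "(real \<Rightarrow> nat \<Rightarrow> 'w \<Rightarrow> real ^ 'd) \<Rightarrow> real \<Rightarrow> 'w \<Rightarrow> real ^ 'd" where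
  "center_of_mass Z t w =
     (let m = nat \<lfloor>t\<rfloor> in (1 / 2 ^ m) *\<^sub>R (\<Sum>i\<in>{1..2 ^ m}. Z t i w))"

text \<open>\<open>Z t i\<close> is the position at time \<open>t\<close> of particle \<open>i \<in> {1..2 ^ nat \<lfloor>t\<rfloor>}\<close>; for other
  indices and for \<open>t < 0\<close> it is irrelevant. \<open>W m i\<close> drives particle \<open>i\<close> during \<open>[m, m + 1)\<close>.
  The labelling of the offspring is encoded by the possibly random maps \<open>parent m\<close>:
  at time \<open>m \<ge> 1\<close>, the new particle \<open>i \<in> {1..2 ^ m}\<close> is an offspring of the old particle
  \<open>parent m i \<in> {1..2 ^ (m - 1)}\<close>. These maps are arbitrary, except that every particle has
  exactly two offspring and that, jointly, they are independent of the Brownian motions.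

  As the noise is additive, the integrated stochastic differential equation holds
  path by path and needs no stochastic integral.\<close>

locale interacting_branching_diffusion = prob_space M
  for M :: "'w measure" +
  fixes b \<gamma> :: real
    and Z :: "real \<Rightarrow> nat \<Rightarrow> 'w \<Rightarrow> real ^ 'd"
    and W :: "nat \<Rightarrow> nat \<Rightarrow> real \<Rightarrow> 'w \<Rightarrow> real ^ 'd"
    and parent :: "nat \<Rightarrow> nat \<Rightarrow> 'w \<Rightarrow> nat"
  assumes Z_measurable:
      "\<And>t i. 0 \<le> t \<Longrightarrow> i \<in> {1..2 ^ nat \<lfloor>t\<rfloor>} \<Longrightarrow> Z t i \<in> borel_measurable M"
    and parent_measurable:
      "\<And>m i. 1 \<le> m \<Longrightarrow> i \<in> {1..2 ^ m} \<Longrightarrow> parent m i \<in> measurable M (count_space UNIV)"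
    and start: "AE w in M. Z 0 1 w = 0"
    and Z_continuous:
      "\<And>m i. i \<in> {1..2 ^ m} \<Longrightarrow>
        AE w in M. continuous_on {real m..<real m + 1} (\<lambda>t. Z t i w)"
    and SDE:
      "\<And>m i. i \<in> {1..2 ^ m} \<Longrightarrow>
        AE w in M. \<forall>t\<in>{real m..<real m + 1}.
          Z t i w = Z (real m) i w + (W m i t w - W m i (real m) w)
            + integral {real m..t} (\<lambda>s. interaction_drift b \<gamma> m (\<lambda>j. Z s j w) i)"
    and two_offspring:
      "\<And>m. 1 \<le> m \<Longrightarrow>
        AE w in M. (\<forall>i\<in>{1..2 ^ m}. parent m i w \<in> {1..2 ^ (m - 1)}) \<and>
          (\<forall>j\<in>{1..2 ^ (m - 1)}. card {i \<in> {1..2 ^ m}. parent m i w = j} = 2)"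
    and born_at_parent:
      "\<And>m i. 1 \<le> m \<Longrightarrow> i \<in> {1..2 ^ m} \<Longrightarrow>
        AE w in M. ((\<lambda>t. Z t (parent m i w) w) \<longlongrightarrow> Z (real m) i w) (at_left (real m))"
    and W_Brownian:
      "\<And>m i. i \<in> {1..2 ^ m} \<Longrightarrow> standard_Brownian_motion_on (real m) (real m + 1) (W m i)"
    and W_indep:
      "\<And>m. indep_sets (\<lambda>i. generated_events M borel (W m i) {real m..<real m + 1}) {1..2 ^ m}"
    and W_indep_past:
      "\<And>m. indep_set
        (generated_events M borel (\<lambda>(i, t). W m i t) ({1..2 ^ m} \<times> {real m..<real m + 1}))
        (sigma_sets (space M)
          (generated_events M borel (\<lambda>(s, i). Z s i)
             (SIGMA s:{0..real m}. {1..2 ^ nat \<lfloor>s\<rfloor>})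
           \<union> generated_events M (count_space UNIV) (\<lambda>(k, i). parent k i)
               (SIGMA k:{1..m}. {1..2 ^ k})))"
    and labels_indep:
      "indep_set
        (generated_events M (count_space UNIV) (\<lambda>(k, i). parent k i)
           (SIGMA k:{1..}. {1..2 ^ k}))
        (generated_events M borel (\<lambda>(m, i, t). W m i t)
           (SIGMA m:UNIV. {1..2 ^ m} \<times> {real m..<real m + 1}))"

end

theory Submission
  imports Defs
begin

text \<open>
  In the average over all particles the pairwise interaction cancels (\<open>sum_interaction_drift\<close>), and
  a branching event does not move the center of mass, since every particle is replaced by the same
  number of copies of itself (\<open>center_of_mass_left_continuous\<close>). Hence the center of mass is a
  continuous path \<open>x\<close>, and on \<open>[m, m + 1)\<close> it is an Ornstein--Uhlenbeck process: it solves
  \<open>x t = x m + \<beta>\<^sub>m t - b \<integral> x\<close>, the integral being over \<open>[m, t]\<close>, where \<open>\<beta>\<^sub>m\<close> is the average of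
  \<open>2 ^ m\<close> independent Brownian motions (\<open>center_of_mass_equation\<close>).

  Averaging reduces the variance of the noise by the factor \<open>2 ^ m\<close>. By a fourth moment estimate and
  dyadic chaining, almost surely the supremum of the norm of \<open>\<beta>\<^sub>m\<close> over \<open>[m, m + 1)\<close> decays
  geometrically in \<open>m\<close> (\<open>mean_noise_decay\<close>).

  Fix such a path. As \<open>b > 0\<close>, the linear drift contracts the norm by the factor \<open>exp (- b)\<close> in each
  unit of time, while the noise adds only a summable sequence of errors. So \<open>x\<close> tends to \<open>0\<close>
  (\<open>perturbed_linear_ode_tendsto_0\<close>); this last part is a statement about a single path, with no
  stochastic calculus.
\<close>

section \<open>Linear equations with a small perturbation\<close>

text \<open>Summing the recursion bounds each partial sum \<open>S\<close> of \<open>a\<close> by \<open>a 0 + r * S + E\<close>, where \<open>E\<close> is the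
  sum of \<open>e\<close>. As \<open>r < 1\<close>, the term \<open>r * S\<close> can be absorbed into the left-hand side.\<close>

lemma summable_contractive_recursion:
  fixes a e :: "nat \<Rightarrow> real"
  assumes a: "\<And>n. 0 \<le> a n" and e: "\<And>n. 0 \<le> e n" "summable e"
    and r: "r < 1" and rec: "\<And>n. a (Suc n) \<le> r * a n + e n"
  shows "summable a"
proof (rule bounded_imp_summable)
  fix N
  define E where "E = suminf e"
  show "(\<Sum>n\<le>N. a n) \<le> (a 0 + E) / (1 - r)"
  proof -
    have "(\<Sum>n\<le>N. a n) \<le> (\<Sum>n\<le>Suc N. a n)"
      using a[of "Suc N"] by simp
    also have "\<dots> = a 0 + (\<Sum>n\<le>N. a (Suc n))"
      by (rule sum.atMost_Suc_shift)
    also have "\<dots> \<le> a 0 + (\<Sum>n\<le>N. r * a n + e n)"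
      by (intro add_left_mono sum_mono rec)
    also have "\<dots> = a 0 + r * (\<Sum>n\<le>N. a n) + (\<Sum>n\<le>N. e n)"
      by (simp add: sum.distrib sum_distrib_left)
    also have "(\<Sum>n\<le>N. e n) \<le> E"
      unfolding E_def by (intro sum_le_suminf) (use e in auto)
    finally show ?thesis
      using r by (simp add: field_simps)
  qed
qed (rule a)

text \<open>The perturbation \<open>\<beta>\<close> need not be differentiable, so the equation is read off for
  \<open>y = x - \<beta>\<close>, which solves \<open>y' = - b y - b \<beta>\<close>. Multiplying by \<open>exp (b (u - a))\<close> leaves a
  function whose derivative has norm at most \<open>b exp (b (u - a)) \<epsilon>\<close>. One \<open>\<epsilon>\<close> comes from
  integrating this, the other from returning from \<open>y\<close> to \<open>x\<close>.\<close>

lemma norm_linear_ode_perturbed: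
  fixes x \<beta> :: "real \<Rightarrow> 'a::euclidean_space"
  assumes b: "b > 0" and at: "a \<le> t" and cont: "continuous_on {a..t} x"
    and eq: "\<And>u. u \<in> {a..t} \<Longrightarrow> x u = x a + \<beta> u - b *\<^sub>R integral {a..u} x"
    and bound: "\<And>u. u \<in> {a..t} \<Longrightarrow> norm (\<beta> u) \<le> \<epsilon>"
  shows "norm (x t) \<le> exp (- b * (t - a)) * norm (x a) + 2 * \<epsilon>"
proof (cases "a = t")
  case True
  have "0 \<le> \<epsilon>"
    using order_trans[OF norm_ge_zero bound[of a]] at by simp
  then show ?thesis using True by simp
next
  case False
  then have lt: "a < t" using at by simp
  define y where "y u = x a - b *\<^sub>R integral {a..u} x" for u
  have y: "(y has_vector_derivative - b *\<^sub>R x u) (at u within {a..t})" if "u \<in> {a..t}" for u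
    unfolding y_def
    by (rule derivative_eq_intros integral_has_vector_derivative[OF cont that] refl)+ simp
  define f where "f u = exp (b * (u - a)) *\<^sub>R y u" for u
  have f: "(f has_vector_derivative - (b * exp (b * (u - a))) *\<^sub>R \<beta> u) (at u within {a..t})"
    if u: "u \<in> {a..t}" for u
  proof -
    have "((\<lambda>u. exp (b * (u - a))) has_real_derivative b * exp (b * (u - a))) (at u within {a..t})"
      by (auto intro!: derivative_eq_intros)
    from has_vector_derivative_scaleR[OF this y[OF u]]
    show ?thesis
      unfolding f_def y_def using eq[OF u] by (simp add: algebra_simps)
  qed
  have "norm (f t - f a) \<le> exp (b * (t - a)) * \<epsilon> - exp (b * (a - a)) * \<epsilon>"
  proof (rule differentiable_bound_general[OF lt])
    show "continuous_on {a..t} f"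
      using f by (meson continuous_on_eq_continuous_within has_vector_derivative_continuous)
    show "continuous_on {a..t} (\<lambda>u. exp (b * (u - a)) * \<epsilon>)"
      by (intro continuous_intros)
    fix u assume u: "a < u" "u < t"
    have "at u within {a..t} = at u"
      using u by (simp add: at_within_Icc_at)
    then show "(f has_vector_derivative - (b * exp (b * (u - a))) *\<^sub>R \<beta> u) (at u)"
      using f[of u] u by simp
    show "((\<lambda>u. exp (b * (u - a)) * \<epsilon>) has_vector_derivative b * exp (b * (u - a)) * \<epsilon>) (at u)"
      unfolding has_real_derivative_iff_has_vector_derivative[symmetric]
      by (auto intro!: derivative_eq_intros)
    show "norm (- (b * exp (b * (u - a))) *\<^sub>R \<beta> u) \<le> b * exp (b * (u - a)) * \<epsilon>"
      using bound[of u] u b by (simp add: mult_left_mono)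
  qed
  moreover have "f a = x a" by (simp add: f_def y_def)
  moreover have "norm (f t) \<le> norm (f a) + norm (f t - f a)"
    by (metis add.commute diff_add_cancel norm_triangle_ineq)
  moreover have eps: "0 \<le> \<epsilon>"
    using order_trans[OF norm_ge_zero bound[of a]] at by simp
  ultimately have "exp (b * (t - a)) * norm (y t) \<le> norm (x a) + exp (b * (t - a)) * \<epsilon>"
    by (simp add: f_def)
  then have "exp (- (b * (t - a))) * (exp (b * (t - a)) * norm (y t))
      \<le> exp (- (b * (t - a))) * (norm (x a) + exp (b * (t - a)) * \<epsilon>)"
    by (rule mult_left_mono) simp
  moreover have "exp (- (b * (t - a))) * (exp (b * (t - a)) * v) = v" for v
    by (simp add: exp_minus)
  ultimately have "norm (y t) \<le> exp (- b * (t - a)) * norm (x a) + \<epsilon>"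
    by (simp add: distrib_left)
  moreover have "x t = y t + \<beta> t"
    using eq[of t] lt by (simp add: y_def)
  ultimately show ?thesis
    using norm_triangle_ineq[of "y t" "\<beta> t"] bound[of t] lt by simp
qed

text \<open>Over one unit of time the norm of \<open>x\<close> contracts by the factor \<open>exp (- b) < 1\<close> up to an error
  \<open>2 \<epsilon> m\<close>, so the norms at integer times are summable. The same estimate controls \<open>x\<close> in between.
  Left continuity at the integers transports the estimate from one interval to the next.\<close>

lemma perturbed_linear_ode_tendsto_0:
  fixes x :: "real \<Rightarrow> 'a::euclidean_space" and \<beta> :: "nat \<Rightarrow> real \<Rightarrow> 'a"
  assumes b: "b > 0"
    and cont: "\<And>m. continuous_on {real m..<real m + 1} x"
    and left: "\<And>m. (x \<longlongrightarrow> x (real (Suc m))) (at_left (real (Suc m)))"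
    and eq: "\<And>m t. t \<in> {real m..<real m + 1} \<Longrightarrow>
      x t = x (real m) + \<beta> m t - b *\<^sub>R integral {real m..t} x"
    and bound: "\<And>m t. t \<in> {real m..<real m + 1} \<Longrightarrow> norm (\<beta> m t) \<le> \<epsilon> m"
    and \<epsilon>: "summable \<epsilon>"
  shows "(x \<longlongrightarrow> 0) at_top"
proof -
  have step: "norm (x t) \<le> exp (- b * (t - real m)) * norm (x (real m)) + 2 * \<epsilon> m"
    if t: "t \<in> {real m..<real m + 1}" for m t
  proof (rule norm_linear_ode_perturbed[OF b, where \<beta> = "\<beta> m"])
    show "continuous_on {real m..t} x"
      by (rule continuous_on_subset[OF cont]) (use t in auto)
  qed (use t eq bound in auto)
  have \<epsilon>_nonneg: "0 \<le> \<epsilon> m" for m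
    using order_trans[OF norm_ge_zero bound[of "real m" m]] by simp
  define a where "a m = norm (x (real m))" for m
  have "a (Suc m) \<le> exp (- b) * a m + 2 * \<epsilon> m" for m
    unfolding a_def
  proof (rule tendsto_le)
    show "((\<lambda>t. norm (x t)) \<longlongrightarrow> norm (x (real (Suc m)))) (at_left (real (Suc m)))"
      by (intro tendsto_norm left)
    have "((\<lambda>t. exp (- b * (t - real m)) * norm (x (real m)) + 2 * \<epsilon> m)
      \<longlongrightarrow> exp (- b * (real (Suc m) - real m)) * norm (x (real m)) + 2 * \<epsilon> m)
      (at_left (real (Suc m)))"
      by (intro tendsto_intros)
    then show "((\<lambda>t. exp (- b * (t - real m)) * norm (x (real m)) + 2 * \<epsilon> m)
      \<longlongrightarrow> exp (- b) * norm (x (real m)) + 2 * \<epsilon> m) (at_left (real (Suc m)))"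
      by simp
    have "eventually (\<lambda>t. t \<in> {real m<..<real (Suc m)}) (at_left (real (Suc m)))"
      by (rule eventually_at_left_real) simp
    then show "\<forall>\<^sub>F t in at_left (real (Suc m)).
        norm (x t) \<le> exp (- b * (t - real m)) * norm (x (real m)) + 2 * \<epsilon> m"
      by eventually_elim (rule step, simp)
  qed simp
  then have "summable a"
    by (intro summable_contractive_recursion[of a "\<lambda>m. 2 * \<epsilon> m" "exp (- b)"])
      (use b \<epsilon> \<epsilon>_nonneg in \<open>auto simp: a_def intro: summable_mult\<close>)
  then have "(\<lambda>m. a m + 2 * \<epsilon> m) \<longlonglongrightarrow> 0 + 2 * 0"
    by (intro tendsto_intros summable_LIMSEQ_zero \<epsilon>)
  moreover have "filterlim (\<lambda>t::real. nat \<lfloor>t\<rfloor>) sequentially at_top"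
    by (rule filterlim_compose[OF filterlim_nat_sequentially filterlim_floor_sequentially])
  ultimately have "((\<lambda>t::real. a (nat \<lfloor>t\<rfloor>) + 2 * \<epsilon> (nat \<lfloor>t\<rfloor>)) \<longlongrightarrow> 0) at_top"
    using filterlim_compose[of "\<lambda>m. a m + 2 * \<epsilon> m" "nhds 0"] by simp
  then show ?thesis
  proof (rule Lim_null_comparison[rotated])
    show "\<forall>\<^sub>F t in at_top. norm (x t) \<le> a (nat \<lfloor>t\<rfloor>) + 2 * \<epsilon> (nat \<lfloor>t\<rfloor>)"
      using eventually_ge_at_top[of 0]
    proof eventually_elim
      case (elim t)
      define m where "m = nat \<lfloor>t\<rfloor>"
      have t: "t \<in> {real m..<real m + 1}"
        using elim by (auto simp: m_def)
      have "exp (- b * (t - real m)) \<le> 1"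
        using b t by simp
      then have "exp (- b * (t - real m)) * a m \<le> 1 * a m"
        by (intro mult_right_mono) (auto simp: a_def)
      then show ?case
        using step[OF t] by (simp add: a_def m_def[symmetric])
    qed
  qed
qed

section \<open>Uniform bounds from fourth moments\<close>

text \<open>A grid point of level \<open>n + 1\<close> is a grid point of level \<open>n\<close> or the right neighbour of one.
  Descending through the levels therefore costs at most one increment per level, and the geometric
  series bounds the total; continuity extends the bound from the dyadic points to the whole
  interval. Since the right end of the interval is excluded, only increments between grid points
  below \<open>a + 1\<close> occur.\<close>

lemma dyadic_chaining:
  fixes f :: "real \<Rightarrow> 'a::real_normed_vector"
  assumes cont: "continuous_on {a..<a + 1} f"
    and q: "0 \<le> q" "q < 1"
    and inc: "\<And>l j. Suc j < 2 ^ l \<Longrightarrow>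
      norm (f (a + real (Suc j) / 2 ^ l) - f (a + real j / 2 ^ l)) \<le> A * q ^ l"
    and A: "0 \<le> A" and t: "t \<in> {a..<a + 1}"
  shows "norm (f t - f a) \<le> A / (1 - q)"
proof -
  have grid: "norm (f (a + real j / 2 ^ n) - f a) \<le> A * (\<Sum>l\<le>n. q ^ l)" if "j < 2 ^ n" for n j
    using that
  proof (induction n arbitrary: j)
    case 0
    then show ?case using A by simp
  next
    case (Suc n)
    define i where "i = j div 2"
    have i: "i < 2 ^ n" using Suc.prems by (simp add: i_def less_mult_imp_div_less)
    have coarse: "real (2 * i) / 2 ^ Suc n = real i / 2 ^ n" by simp
    show ?case
    proof (cases "even j")
      case True
      then have "j = 2 * i" by (simp add: i_def)
      then have "norm (f (a + real j / 2 ^ Suc n) - f a) \<le> A * (\<Sum>l\<le>n. q ^ l)"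
        using Suc.IH[OF i] coarse by metis
      also have "\<dots> \<le> A * (\<Sum>l\<le>Suc n. q ^ l)"
        using A q by (intro mult_left_mono) auto
      finally show ?thesis .
    next
      case False
      then have j: "j = Suc (2 * i)" by (simp add: i_def)
      have "norm (f (a + real j / 2 ^ Suc n) - f a)
        \<le> norm (f (a + real j / 2 ^ Suc n) - f (a + real (2 * i) / 2 ^ Suc n))
          + norm (f (a + real (2 * i) / 2 ^ Suc n) - f a)"
        using norm_triangle_ineq[of "f (a + real j / 2 ^ Suc n) - f (a + real (2 * i) / 2 ^ Suc n)"
            "f (a + real (2 * i) / 2 ^ Suc n) - f a"] by simp
      also have "\<dots> \<le> A * q ^ Suc n + A * (\<Sum>l\<le>n. q ^ l)"
        using inc[of "2 * i" "Suc n"] Suc.IH[OF i] Suc.prems unfolding j coarse by (intro add_mono) auto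
      also have "\<dots> = A * (\<Sum>l\<le>Suc n. q ^ l)"
        by (simp add: distrib_left)
      finally show ?thesis .
    qed
  qed
  define s where "s n = a + real (nat \<lfloor>2 ^ n * (t - a)\<rfloor>) / 2 ^ n" for n
  have nonneg: "0 \<le> t - a" "t - a < 1" using t by auto
  have s_eq: "s n = a + of_int \<lfloor>2 ^ n * (t - a)\<rfloor> / 2 ^ n" for n
    using nonneg by (simp add: s_def)
  have s_le: "s n \<le> t" "t - (1 / 2) ^ n \<le> s n" for n
  proof -
    have "of_int \<lfloor>2 ^ n * (t - a)\<rfloor> / 2 ^ n \<le> 2 ^ n * (t - a) / 2 ^ n"
      by (intro divide_right_mono) auto
    then show "s n \<le> t" unfolding s_eq by simp
    have "(2 ^ n * (t - a) - 1) / 2 ^ n \<le> of_int \<lfloor>2 ^ n * (t - a)\<rfloor> / 2 ^ n"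
      by (intro divide_right_mono) (linarith, simp)
    then show "t - (1 / 2) ^ n \<le> s n" unfolding s_eq by (simp add: diff_divide_distrib power_one_over)
  qed
  have lim: "s \<longlonglongrightarrow> t"
  proof (rule tendsto_sandwich)
    have "(\<lambda>n. t - (1 / 2) ^ n) \<longlonglongrightarrow> t - 0"
      by (intro tendsto_intros LIMSEQ_realpow_zero) auto
    then show "(\<lambda>n. t - (1 / 2) ^ n) \<longlonglongrightarrow> t" by simp
  qed (use s_le in auto)
  have s_in: "s n \<in> {a..<a + 1}" for n
  proof -
    have "a \<le> s n" by (simp add: s_def)
    then show ?thesis using s_le(1)[of n] t by simp
  qed
  have "(\<lambda>n. f (s n)) \<longlonglongrightarrow> f t"
    using cont t lim s_in unfolding continuous_on_sequentially by (auto simp: o_def)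
  then have "(\<lambda>n. norm (f (s n) - f a)) \<longlonglongrightarrow> norm (f t - f a)"
    by (intro tendsto_intros)
  moreover have "norm (f (s n) - f a) \<le> A / (1 - q)" for n
  proof -
    have "of_int \<lfloor>2 ^ n * (t - a)\<rfloor> \<le> 2 ^ n * (t - a)" by simp
    also have "\<dots> < 2 ^ n * 1"
      using nonneg by (intro mult_strict_left_mono) auto
    finally have "\<lfloor>2 ^ n * (t - a)\<rfloor> < 2 ^ n"
      by (metis mult.right_neutral of_int_less_iff of_int_numeral of_int_power)
    then have "nat \<lfloor>2 ^ n * (t - a)\<rfloor> < 2 ^ n"
      using nonneg by (simp add: nat_less_iff)
    then have "norm (f (s n) - f a) \<le> A * (\<Sum>l\<le>n. q ^ l)"
      unfolding s_def by (rule grid)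
    also have "(\<Sum>l\<le>n. q ^ l) \<le> suminf (\<lambda>l. q ^ l)"
      by (rule sum_le_suminf) (use q in \<open>auto intro: summable_geometric\<close>)
    also have "\<dots> = 1 / (1 - q)"
      using q by (simp add: suminf_geometric)
    finally show ?thesis
      using A by (simp add: mult_left_mono)
  qed
  ultimately show ?thesis
    by (intro LIMSEQ_le_const2) auto
qed

text \<open>This is the moment argument of Kolmogorov and Chentsov, run for all intervals at once. Divide each
  dyadic increment of level \<open>l\<close> in the \<open>m\<close>-th interval by \<open>q ^ (m + l)\<close> and add up the fourth
  powers over all \<open>m\<close>, \<open>l\<close> and grid points. An increment has fourth moment at most
  \<open>K * (1/4) ^ (m + l)\<close>, and there are fewer than \<open>2 ^ l\<close> of them, so with \<open>r = 1 / (4 q ^ 4)\<close>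
  the expected sum is at most the sum of \<open>K * r ^ m * (2 r) ^ l\<close>. It is finite when \<open>q ^ 4 > 1/2\<close>,
  and \<open>q = 9/10\<close> is such a number below one. So the sum is almost surely finite, which bounds every
  increment by \<open>A * q ^ (m + l)\<close> with one random \<open>A\<close>; chaining does the rest.\<close>

lemma (in prob_space) uniform_decay_from_fourth_moments:
  fixes X :: "nat \<Rightarrow> real \<Rightarrow> 'a \<Rightarrow> real"
  assumes meas: "\<And>m t. t \<in> {real m..<real m + 1} \<Longrightarrow> X m t \<in> borel_measurable M"
    and cont: "\<And>m. AE w in M. continuous_on {real m..<real m + 1} (\<lambda>t. X m t w)"
    and moment: "\<And>m s t. real m \<le> s \<Longrightarrow> s < t \<Longrightarrow> t < real m + 1 \<Longrightarrow>
      (\<integral>\<^sup>+w. ennreal ((X m t w - X m s w) ^ 4) \<partial>M) \<le> ennreal (K * ((t - s) / 2 ^ m)\<^sup>2)"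
    and K: "0 \<le> K"
  shows "AE w in M. \<exists>A\<ge>0. \<forall>m. \<forall>t\<in>{real m..<real m + 1}.
    \<bar>X m t w - X m (real m) w\<bar> \<le> A * (9 / 10) ^ m"
proof -
  define q :: real where "q = 9 / 10"
  define r :: real where "r = 1 / (4 * q ^ 4)"
  have q: "0 < q" "q < 1" and r: "0 < r" "2 * r < 1"
    by (auto simp: q_def r_def power_divide)
  define D where
    "D m l j w = X m (real m + real (Suc j) / 2 ^ l) w - X m (real m + real j / 2 ^ l) w" for m l j w
  define G where "G m l w = (\<Sum>j | Suc j < 2 ^ l. ennreal (D m l j w ^ 4 / (q ^ (m + l)) ^ 4))" for m l w
  have grid: "real m + real j / 2 ^ l \<in> {real m..<real m + 1}" if "j < 2 ^ l" for m l j :: nat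
  proof -
    have "real j < 2 ^ l" using that by (metis of_nat_less_iff of_nat_numeral of_nat_power)
    then show ?thesis by simp
  qed
  have fin: "finite {j::nat. Suc j < 2 ^ l}" for l
    by (rule finite_subset[of _ "{..<2 ^ l}"]) auto
  have D_meas: "D m l j \<in> borel_measurable M" if "Suc j < 2 ^ l" for m l j
    unfolding D_def by (intro borel_measurable_diff meas grid) (use that in auto)
  have G_meas[measurable]: "G m l \<in> borel_measurable M" for m l
    unfolding G_def
    by (intro borel_measurable_sum measurable_compose[OF _ measurable_ennreal]
        borel_measurable_divide borel_measurable_power borel_measurable_const D_meas) auto
  have D_moment: "(\<integral>\<^sup>+w. ennreal (D m l j w ^ 4 / (q ^ (m + l)) ^ 4) \<partial>M) \<le> ennreal (K * r ^ (m + l))"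
    if j: "Suc j < 2 ^ l" for m l j
  proof -
    have "(\<integral>\<^sup>+w. ennreal (D m l j w ^ 4 / (q ^ (m + l)) ^ 4) \<partial>M)
        = (\<integral>\<^sup>+w. ennreal (1 / (q ^ (m + l)) ^ 4) * ennreal (D m l j w ^ 4) \<partial>M)"
      using q by (intro nn_integral_cong) (simp flip: ennreal_mult)
    also have "\<dots> = ennreal (1 / (q ^ (m + l)) ^ 4) * (\<integral>\<^sup>+w. ennreal (D m l j w ^ 4) \<partial>M)"
      using D_meas[OF j] by (intro nn_integral_cmult) measurable
    also have "(\<integral>\<^sup>+w. ennreal (D m l j w ^ 4) \<partial>M)
        \<le> ennreal (K * (((real m + real (Suc j) / 2 ^ l) - (real m + real j / 2 ^ l)) / 2 ^ m)\<^sup>2)"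
      unfolding D_def
      by (rule moment) (use grid[OF j, of m] in \<open>auto simp: divide_strict_right_mono\<close>)
    also have "((real m + real (Suc j) / 2 ^ l) - (real m + real j / 2 ^ l)) / 2 ^ m = 1 / 2 ^ (m + l)"
      by (simp add: field_simps power_add)
    also have "ennreal (1 / (q ^ (m + l)) ^ 4) * ennreal (K * (1 / 2 ^ (m + l))\<^sup>2)
        = ennreal (1 / (q ^ (m + l)) ^ 4 * (K * (1 / 2 ^ (m + l))\<^sup>2))"
      using q K by (simp flip: ennreal_mult)
    also have "1 / (q ^ (m + l)) ^ 4 * (K * (1 / 2 ^ (m + l))\<^sup>2) = K * r ^ (m + l)"
    proof -
      have "r ^ (m + l) = 1 / (4 ^ (m + l) * (q ^ 4) ^ (m + l))"
        by (simp add: r_def power_divide power_mult_distrib)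
      also have "(q ^ 4) ^ (m + l) = (q ^ (m + l)) ^ 4"
        by (metis power_mult mult.commute)
      also have "(4::real) ^ (m + l) = (2 ^ (m + l))\<^sup>2"
        by (metis power_mult mult.commute four_x_squared numeral_power_eq_of_nat_cancel_iff power2_eq_square num_double numeral_times_numeral)
      finally show ?thesis by (simp add: power_divide)
    qed
    finally show ?thesis by (simp add: mult_left_mono)
  qed
  have G_int: "(\<integral>\<^sup>+w. G m l w \<partial>M) \<le> ennreal (K * r ^ m * (2 * r) ^ l)" for m l
  proof -
    have "(\<integral>\<^sup>+w. G m l w \<partial>M)
        = (\<Sum>j | Suc j < 2 ^ l. \<integral>\<^sup>+w. ennreal (D m l j w ^ 4 / (q ^ (m + l)) ^ 4) \<partial>M)"
      unfolding G_def
      by (intro nn_integral_sum measurable_compose[OF _ measurable_ennreal]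
        borel_measurable_divide borel_measurable_power borel_measurable_const D_meas) auto
    also have "\<dots> \<le> (\<Sum>j | Suc j < 2 ^ l. ennreal (K * r ^ (m + l)))"
      by (intro sum_mono D_moment) simp
    also have "\<dots> \<le> (\<Sum>j<(2::nat) ^ l. ennreal (K * r ^ (m + l)))"
      by (intro sum_mono2) auto
    also have "\<dots> = ennreal (\<Sum>j<(2::nat) ^ l. K * r ^ (m + l))"
      using K r by (intro sum_ennreal) auto
    also have "(\<Sum>j<(2::nat) ^ l. K * r ^ (m + l)) = K * r ^ m * (2 * r) ^ l"
      by (simp add: power_add power_mult_distrib)
    finally show ?thesis .
  qed
  have "(\<integral>\<^sup>+w. (\<Sum>m l. G m l w) \<partial>M) = (\<Sum>m l. \<integral>\<^sup>+w. G m l w \<partial>M)"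
    by (simp add: nn_integral_suminf)
  also have "\<dots> \<le> (\<Sum>m l. ennreal (K * r ^ m * (2 * r) ^ l))"
    by (intro suminf_le G_int) auto
  also have "\<dots> = (\<Sum>m. ennreal (K * r ^ m * (1 / (1 - 2 * r))))"
    by (intro suminf_cong suminf_ennreal_eq sums_mult geometric_sums) (use K r in auto)
  also have "\<dots> = ennreal (K * (1 / (1 - r)) * (1 / (1 - 2 * r)))"
    by (intro suminf_ennreal_eq sums_mult sums_mult2 geometric_sums) (use K r in auto)
  finally have "(\<integral>\<^sup>+w. (\<Sum>m l. G m l w) \<partial>M) \<noteq> \<infinity>"
    by (auto simp: top_unique)
  then have "AE w in M. (\<Sum>m l. G m l w) \<noteq> \<infinity>"
    by (intro nn_integral_PInf_AE) measurable
  moreover have "AE w in M. \<forall>m. continuous_on {real m..<real m + 1} (\<lambda>t. X m t w)"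
    using cont by (simp add: AE_all_countable)
  ultimately show ?thesis
  proof eventually_elim
    case (elim w)
    define S where "S = enn2real (\<Sum>m l. G m l w)"
    \<comment> \<open>The maximum with one gives \<open>S \<le> A ^ 4\<close> without a fourth root.\<close>
    define A where "A = max 1 S"
    have S: "ennreal S = (\<Sum>m l. G m l w)"
      using elim(1) by (simp add: S_def less_top)
    have inc: "\<bar>D m l j w\<bar> \<le> A * q ^ m * q ^ l" if j: "Suc j < 2 ^ l" for m l j
    proof -
      have "ennreal (D m l j w ^ 4 / (q ^ (m + l)) ^ 4) \<le> G m l w"
        unfolding G_def by (rule member_le_sum) (use j fin in auto)
      also have "\<dots> \<le> (\<Sum>l. G m l w)"
        using sum_le_suminf[of "\<lambda>l. G m l w" "{l}"] by simp
      also have "\<dots> \<le> (\<Sum>m l. G m l w)"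
        using sum_le_suminf[of "\<lambda>m. \<Sum>l. G m l w" "{m}"] by simp
      finally have "D m l j w ^ 4 / (q ^ (m + l)) ^ 4 \<le> S"
        unfolding S[symmetric] by (subst (asm) ennreal_le_iff) (simp_all add: S_def)
      also have "S \<le> A ^ 4"
        using self_le_power[of A 4] by (simp add: A_def)
      finally have "D m l j w ^ 4 \<le> (A * q ^ (m + l)) ^ 4"
        using q by (simp add: divide_le_eq power_mult_distrib)
      then have "\<bar>D m l j w\<bar> ^ 4 \<le> (A * q ^ (m + l)) ^ 4"
        by (simp add: power_even_abs)
      then have "\<bar>D m l j w\<bar> \<le> A * q ^ (m + l)"
        by (rule power_le_imp_le_base[of _ 3, simplified]) (use q in \<open>simp add: A_def\<close>)
      then show ?thesis by (simp add: power_add mult.assoc)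
    qed
    have "\<bar>X m t w - X m (real m) w\<bar> \<le> A / (1 - q) * q ^ m"
      if t: "t \<in> {real m..<real m + 1}" for m t
    proof -
      have "norm (X m t w - X m (real m) w) \<le> A * q ^ m / (1 - q)"
        by (rule dyadic_chaining[of "real m" "\<lambda>t. X m t w"])
          (use elim(2) inc t q in \<open>auto simp: D_def A_def\<close>)
      then show ?thesis by simp
    qed
    moreover have "0 \<le> A / (1 - q)"
      using q by (simp add: A_def)
    ultimately show ?case
      unfolding q_def[symmetric] by blast
  qed
qed

section \<open>The average of the driving Brownian motions\<close>

text \<open>A product density integrates coordinate by coordinate, and the coordinates other than \<open>k\<close>
  contribute a factor one.\<close>

lemma (in prob_space) distributed_cart_component:
  fixes X :: "'a \<Rightarrow> real ^ 'd" and f :: "'d \<Rightarrow> real \<Rightarrow> real"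
  assumes X: "distributed M lborel X (\<lambda>x. ennreal (\<Prod>k\<in>UNIV. f k (x $ k)))"
    and f[measurable]: "\<And>k. f k \<in> borel_measurable borel" and nonneg: "\<And>k x. 0 \<le> f k x"
    and total: "\<And>k. (\<integral>\<^sup>+x. ennreal (f k x) \<partial>lborel) = 1"
  shows "distributed M lborel (\<lambda>w. X w $ k) (\<lambda>x. ennreal (f k x))"
  unfolding distributed_def
proof (intro conjI)
  have X_meas[measurable]: "X \<in> borel_measurable M"
    using X by (simp add: distributed_def)
  show meas: "(\<lambda>w. X w $ k) \<in> measurable M lborel"
    by (simp add: cart_eq_inner_axis)
  show "distr M lborel (\<lambda>w. X w $ k) = density lborel (\<lambda>x. ennreal (f k x))"
  proof (rule measure_eqI)
    fix A assume "A \<in> sets (distr M lborel (\<lambda>w. X w $ k))"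
    then have A[measurable]: "A \<in> sets borel" by simp
    \<comment> \<open>The integral formula for products ranges over basis vectors; a definite description recovers the
        coordinate from its basis vector.\<close>
    define h :: "real ^ 'd \<Rightarrow> real \<Rightarrow> ennreal" where
      "h b x = ennreal (f (THE j. b = axis j 1) x) * (if b = axis k 1 then indicator A x else 1)" for b x
    have h: "h (axis j 1) x = ennreal (f j x) * (if j = k then indicator A x else 1)" for j x
      by (simp add: h_def axis_eq_axis)
    have Basis: "(Basis :: (real ^ 'd) set) = (\<lambda>j. axis j 1) ` UNIV"
      by (auto simp: Basis_vec_def)
    have prod_Basis: "(\<Prod>b\<in>Basis. g b) = (\<Prod>j\<in>UNIV. g (axis j 1))"
      for g :: "real ^ 'd \<Rightarrow> ennreal"
      unfolding Basis by (subst prod.reindex) (auto simp: inj_on_def axis_eq_axis)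
    have "emeasure (distr M lborel (\<lambda>w. X w $ k)) A
        = (\<integral>\<^sup>+w. indicator A (X w $ k) \<partial>M)"
      using meas by (simp add: nn_integral_distr flip: nn_integral_indicator)
    also have "\<dots> = (\<integral>\<^sup>+x. ennreal (\<Prod>j\<in>UNIV. f j (x $ j)) * indicator A (x $ k) \<partial>lborel)"
      by (rule distributed_nn_integral[OF X, symmetric]) measurable
    also have "\<dots> = (\<integral>\<^sup>+x. (\<Prod>b\<in>Basis. h b (x \<bullet> b)) \<partial>lborel)"
      by (intro nn_integral_cong)
        (simp add: prod_Basis h inner_axis prod.distrib prod.delta prod_ennreal nonneg)
    also have "\<dots> = (\<Prod>b\<in>Basis. (\<integral>\<^sup>+x. h b x \<partial>lborel))"
      by (rule nn_integral_lborel_prod) (auto simp: h_def)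
    also have "\<dots> = (\<Prod>j\<in>UNIV. if j = k then (\<integral>\<^sup>+x. ennreal (f k x) * indicator A x \<partial>lborel) else 1)"
      unfolding prod_Basis h by (intro prod.cong refl) (simp add: total)
    also have "\<dots> = (\<integral>\<^sup>+x. ennreal (f k x) * indicator A x \<partial>lborel)"
      by (simp add: prod.delta)
    also have "\<dots> = emeasure (density lborel (\<lambda>x. ennreal (f k x))) A"
      by (simp add: emeasure_density)
    finally show "emeasure (distr M lborel (\<lambda>w. X w $ k)) A
        = emeasure (density lborel (\<lambda>x. ennreal (f k x))) A" .
  qed simp
qed simp

lemma (in prob_space) fourth_moment_normal:
  assumes X: "distributed M lborel X (normal_density 0 \<sigma>)" and \<sigma>: "0 < \<sigma>"
  shows "(\<integral>\<^sup>+w. ennreal (X w ^ 4) \<partial>M) = ennreal (3 * \<sigma> ^ 4)"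
proof -
  have "(\<integral>\<^sup>+w. ennreal (X w ^ 4) \<partial>M)
      = (\<integral>\<^sup>+x. ennreal (normal_density 0 \<sigma> x) * ennreal (x ^ 4) \<partial>lborel)"
    by (rule distributed_nn_integral[OF X, symmetric]) measurable
  also have "\<dots> = (\<integral>\<^sup>+x. ennreal (normal_density 0 \<sigma> x * x ^ 4) \<partial>lborel)"
    by (simp add: ennreal_mult'')
  also have "\<dots> = ennreal (3 * \<sigma> ^ 4)"
  proof (rule nn_integral_eq_integral[THEN trans])
    have *: "has_bochner_integral lborel (\<lambda>x. normal_density 0 \<sigma> x * x ^ 4) (3 * \<sigma> ^ 4)"
      using normal_moment_even[OF \<sigma>, of 0 2] \<sigma>
      by (simp add: fact_numeral power_divide field_simps)
    then show "integrable lborel (\<lambda>x. normal_density 0 \<sigma> x * x ^ 4)"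
      by (simp add: has_bochner_integral_iff)
    show "ennreal (integral\<^sup>L lborel (\<lambda>x. normal_density 0 \<sigma> x * x ^ 4)) = ennreal (3 * \<sigma> ^ 4)"
      using * by (simp add: has_bochner_integral_iff)
  qed auto
  finally show ?thesis .
qed

text \<open>The sigma-algebra behind \<^const>\<open>generated_events\<close> as a measurable space, so that the
  measurability prover can show that events defined by functions of the \<open>X i\<close> belong to it.\<close>

lemma measurable_sigma_generated:
  fixes X :: "'i \<Rightarrow> 'w \<Rightarrow> 'b::topological_space"
  assumes "i \<in> I"
  shows "X i \<in> borel_measurable (sigma (space M) (\<Union>i\<in>I. {X i -` A \<inter> space M | A. A \<in> sets borel}))"
    (is "_ \<in> borel_measurable (sigma _ ?G)")
proof (rule measurableI)
  have G: "?G \<subseteq> Pow (space M)" by auto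
  fix A :: "'b set" assume "A \<in> sets borel"
  then have "X i -` A \<inter> space M \<in> ?G" using assms by blast
  then show "X i -` A \<inter> space (sigma (space M) ?G) \<in> sets (sigma (space M) ?G)"
    using G by (simp add: space_measure_of sets_measure_of sigma_sets.Basic)
qed simp

definition mean_noise :: "(nat \<Rightarrow> nat \<Rightarrow> real \<Rightarrow> 'w \<Rightarrow> real ^ 'd) \<Rightarrow> nat \<Rightarrow> real \<Rightarrow> 'w \<Rightarrow> real ^ 'd" where
  "mean_noise W m t w = (1 / 2 ^ m) *\<^sub>R (\<Sum>i\<in>{1..2 ^ m}. W m i t w)"

context interacting_branching_diffusion
begin

lemma distributed_noise_increment_component:
  assumes i: "i \<in> {1..2 ^ m}" and st: "real m \<le> s" "s < t" "t < real m + 1"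
  shows "distributed M lborel (\<lambda>w. (W m i t w - W m i s w) $ k) (normal_density 0 (sqrt (t - s)))"
proof (rule distributed_cart_component)
  show "distributed M lborel (\<lambda>w. W m i t w - W m i s w)
      (\<lambda>x. ennreal (\<Prod>k\<in>UNIV. normal_density 0 (sqrt (t - s)) (x $ k)))"
    using W_Brownian[OF i] st by (simp add: standard_Brownian_motion_on_def)
  show "(\<integral>\<^sup>+x. ennreal (normal_density 0 (sqrt (t - s)) x) \<partial>lborel) = 1"
    using st by (subst nn_integral_eq_integral) auto
qed auto

text \<open>An increment is a function of its Brownian path, so it inherits the independence of the
  sigma-algebras that the paths generate.\<close>

lemma indep_noise_increment_components:
  assumes st: "s \<in> {real m..<real m + 1}" "t \<in> {real m..<real m + 1}"
  shows "indep_vars (\<lambda>_. borel) (\<lambda>i w. (W m i t w - W m i s w) $ k) {1..2 ^ m}"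
  unfolding indep_vars_def2
proof (intro conjI ballI)
  fix i :: nat assume i: "i \<in> {1..2 ^ m}"
  have [measurable]: "W m i t \<in> borel_measurable M" "W m i s \<in> borel_measurable M"
    using W_Brownian[OF i] st by (auto simp: standard_Brownian_motion_on_def)
  show "(\<lambda>w. (W m i t w - W m i s w) $ k) \<in> borel_measurable M"
    unfolding cart_eq_inner_axis by measurable
next
  show "indep_sets (\<lambda>i. {(\<lambda>w. (W m i t w - W m i s w) $ k) -` A \<inter> space M |A. A \<in> sets borel})
      {1..2 ^ m}"
  proof (rule indep_sets_mono_sets[OF W_indep])
    fix i :: nat
    let ?G = "\<Union>u\<in>{real m..<real m + 1}. {W m i u -` A \<inter> space M | A. A \<in> sets borel}"
    let ?N = "sigma (space M) ?G"
    have G: "?G \<subseteq> Pow (space M)" by auto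
    have [measurable]: "W m i t \<in> borel_measurable ?N" "W m i s \<in> borel_measurable ?N"
      by (rule measurable_sigma_generated, fact)+
    have "(\<lambda>w. (W m i t w - W m i s w) $ k) \<in> borel_measurable ?N"
      unfolding cart_eq_inner_axis by measurable
    then have "(\<lambda>w. (W m i t w - W m i s w) $ k) -` A \<inter> space ?N \<in> sets ?N"
      if "A \<in> sets borel" for A
      using that by (rule measurable_sets)
    then show "{(\<lambda>w. (W m i t w - W m i s w) $ k) -` A \<inter> space M |A. A \<in> sets borel}
        \<subseteq> generated_events M borel (W m i) {real m..<real m + 1}"
      using G by (auto simp: generated_events_def space_measure_of sets_measure_of)
  qed
qed

text \<open>Each coordinate of the increment is an average of \<open>2 ^ m\<close> independent centred normal variables of
  variance \<open>t - s\<close>, hence centred normal of variance \<open>(t - s) / 2 ^ m\<close>. Averaging over more and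
  more particles is what makes the noise die out.\<close>

lemma fourth_moment_mean_noise_increment:
  assumes st: "real m \<le> s" "s < t" "t < real m + 1"
  shows "(\<integral>\<^sup>+w. ennreal ((mean_noise W m t w $ k - mean_noise W m s w $ k) ^ 4) \<partial>M)
    = ennreal (3 * ((t - s) / 2 ^ m)\<^sup>2)"
proof -
  define S where "S w = (\<Sum>i\<in>{1..2 ^ m}. (W m i t w - W m i s w) $ k)" for w
  define v where "v = 2 ^ m * (t - s)"
  have v: "0 < v" using st by (simp add: v_def)
  have "distributed M lborel S
      (normal_density (\<Sum>i\<in>{1..(2::nat) ^ m}. 0) (sqrt (\<Sum>i\<in>{1..(2::nat) ^ m}. (sqrt (t - s))\<^sup>2)))"
    unfolding S_def
  proof (rule sum_indep_normal)
    show "indep_vars (\<lambda>_. borel) (\<lambda>i w. (W m i t w - W m i s w) $ k) {1..2 ^ m}"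
      by (rule indep_noise_increment_components) (use st in auto)
    show "distributed M lborel (\<lambda>w. (W m i t w - W m i s w) $ k) (normal_density 0 (sqrt (t - s)))"
      if "i \<in> {1..2 ^ m}" for i
      by (rule distributed_noise_increment_component[OF that st])
  qed (use st in auto)
  then have S: "distributed M lborel S (normal_density 0 (sqrt v))"
    using st by (simp add: v_def)
  then have [measurable]: "S \<in> borel_measurable M"
    by (simp add: distributed_def)
  have "mean_noise W m t w $ k - mean_noise W m s w $ k = S w / 2 ^ m" for w
    by (simp add: mean_noise_def S_def sum_subtractf diff_divide_distrib)
  then have "(\<integral>\<^sup>+w. ennreal ((mean_noise W m t w $ k - mean_noise W m s w $ k) ^ 4) \<partial>M)
      = (\<integral>\<^sup>+w. ennreal (1 / (2 ^ m) ^ 4) * ennreal (S w ^ 4) \<partial>M)"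
    by (intro nn_integral_cong) (simp add: power_divide flip: ennreal_mult)
  also have "\<dots> = ennreal (1 / (2 ^ m) ^ 4) * ennreal (3 * sqrt v ^ 4)"
    using fourth_moment_normal[OF S] v by (subst nn_integral_cmult) auto
  also have "\<dots> = ennreal (1 / (2 ^ m) ^ 4 * (3 * sqrt v ^ 4))"
    by (simp flip: ennreal_mult)
  also have "sqrt v ^ 4 = v\<^sup>2"
    using v power_mult[of "sqrt v" 2 2] by simp
  also have "1 / (2 ^ m) ^ 4 * (3 * v\<^sup>2) = 3 * ((t - s) / 2 ^ m)\<^sup>2"
    by (simp add: v_def field_simps power2_eq_square power4_eq_xxxx)
  finally show ?thesis .
qed

lemma mean_noise_decay:
  "AE w in M. \<exists>A. \<forall>m. \<forall>t\<in>{real m..<real m + 1}.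
    norm (mean_noise W m t w - mean_noise W m (real m) w) \<le> A * (9 / 10) ^ m"
proof -
  have W_cont: "AE w in M. \<forall>m. \<forall>i\<in>{1..2 ^ m}. continuous_on {real m..<real m + 1} (\<lambda>t. W m i t w)"
    using W_Brownian by (auto simp: AE_all_countable AE_ball_countable standard_Brownian_motion_on_def)
  have "AE w in M. \<exists>A\<ge>0. \<forall>m. \<forall>t\<in>{real m..<real m + 1}.
    \<bar>mean_noise W m t w $ k - mean_noise W m (real m) w $ k\<bar> \<le> A * (9 / 10) ^ m" for k
  proof (rule uniform_decay_from_fourth_moments)
    fix m :: nat and t :: real assume t: "t \<in> {real m..<real m + 1}"
    have "W m i t \<in> borel_measurable M" if "i \<in> {1..2 ^ m}" for i
      using W_Brownian[OF that] t by (auto simp: standard_Brownian_motion_on_def)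
    then show "(\<lambda>w. mean_noise W m t w $ k) \<in> borel_measurable M"
      unfolding mean_noise_def cart_eq_inner_axis
      by (intro borel_measurable_inner borel_measurable_scaleR borel_measurable_sum
          borel_measurable_const) auto
  next
    show "AE w in M. continuous_on {real m..<real m + 1} (\<lambda>t. mean_noise W m t w $ k)" for m
      using W_cont
      by eventually_elim (auto simp: mean_noise_def intro!: continuous_intros)
  next
    show "(\<integral>\<^sup>+w. ennreal ((mean_noise W m t w $ k - mean_noise W m s w $ k) ^ 4) \<partial>M)
      \<le> ennreal (3 * ((t - s) / 2 ^ m)\<^sup>2)"
      if "real m \<le> s" "s < t" "t < real m + 1" for m s t
      using fourth_moment_mean_noise_increment[OF that] by simp
  qed simp
  then have "AE w in M. \<forall>k. \<exists>A\<ge>0. \<forall>m. \<forall>t\<in>{real m..<real m + 1}.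
    \<bar>mean_noise W m t w $ k - mean_noise W m (real m) w $ k\<bar> \<le> A * (9 / 10) ^ m"
    by (simp add: AE_all_countable)
  then show ?thesis
  proof eventually_elim
    case (elim w)
    then obtain A where A: "\<And>k m t. t \<in> {real m..<real m + 1} \<Longrightarrow>
      \<bar>mean_noise W m t w $ k - mean_noise W m (real m) w $ k\<bar> \<le> A k * (9 / 10) ^ m"
      by metis
    have "norm (mean_noise W m t w - mean_noise W m (real m) w) \<le> (\<Sum>k\<in>UNIV. A k) * (9 / 10) ^ m"
      if "t \<in> {real m..<real m + 1}" for m t
    proof -
      have "norm (mean_noise W m t w - mean_noise W m (real m) w)
        \<le> (\<Sum>k\<in>UNIV. \<bar>(mean_noise W m t w - mean_noise W m (real m) w) $ k\<bar>)"
        by (rule norm_le_l1_cart)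
      also have "\<dots> \<le> (\<Sum>k\<in>UNIV. A k * (9 / 10) ^ m)"
        using A[OF that] by (intro sum_mono) simp
      finally show ?thesis by (simp add: sum_distrib_right)
    qed
    then show ?case by blast
  qed
qed

end

section \<open>The equation of the center of mass\<close>

text \<open>The pair interaction is antisymmetric, so it cancels in the sum over all particles.\<close>

lemma sum_interaction_drift:
  "(\<Sum>i\<in>{1..2 ^ m}. interaction_drift b \<gamma> m x i) = - b *\<^sub>R (\<Sum>i\<in>{1..2 ^ m}. x i)"
proof -
  have "(\<Sum>i\<in>{1..2 ^ m}. \<Sum>j\<in>{1..2 ^ m}. \<gamma> *\<^sub>R (x j - x i)) = 0"
    using sum.swap[of "\<lambda>i j. \<gamma> *\<^sub>R x j" "{1..2 ^ m :: nat}" "{1..2 ^ m :: nat}"]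
    by (simp add: scaleR_diff_right sum_subtractf del: sum_constant)
  moreover have "(\<Sum>i\<in>{1..2 ^ m}. interaction_drift b \<gamma> m x i)
      = - b *\<^sub>R (\<Sum>i\<in>{1..2 ^ m}. x i)
        + (1 / 2 ^ m) *\<^sub>R (\<Sum>i\<in>{1..2 ^ m}. \<Sum>j\<in>{1..2 ^ m}. \<gamma> *\<^sub>R (x j - x i))"
    by (simp only: interaction_drift_def sum.distrib scaleR_sum_right)
  ultimately show ?thesis by simp
qed

lemma center_of_mass_eq:
  assumes "t \<in> {real m..<real m + 1}"
  shows "center_of_mass Z t w = (1 / 2 ^ m) *\<^sub>R (\<Sum>i\<in>{1..2 ^ m}. Z t i w)"
proof -
  have "\<lfloor>t\<rfloor> = int m" using assms by (simp add: floor_eq_iff)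
  then show ?thesis by (simp add: center_of_mass_def)
qed

context interacting_branching_diffusion
begin

lemma center_of_mass_continuous:
  "AE w in M. \<forall>m. continuous_on {real m..<real m + 1} (\<lambda>t. center_of_mass Z t w)"
proof -
  have "AE w in M. \<forall>m. \<forall>i\<in>{1..2 ^ m}. continuous_on {real m..<real m + 1} (\<lambda>t. Z t i w)"
    using Z_continuous by (simp add: AE_all_countable AE_ball_countable)
  then show ?thesis
  proof eventually_elim
    case (elim w)
    then have "continuous_on {real m..<real m + 1} (\<lambda>t. (1 / 2 ^ m) *\<^sub>R (\<Sum>i\<in>{1..2 ^ m}. Z t i w))" for m
      by (intro continuous_intros) auto
    then show ?case
      by (simp add: center_of_mass_eq cong: continuous_on_cong_simp)
  qed
qed

lemma center_of_mass_equation: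
  "AE w in M. \<forall>m. \<forall>t\<in>{real m..<real m + 1}.
    center_of_mass Z t w = center_of_mass Z (real m) w
      + (mean_noise W m t w - mean_noise W m (real m) w)
      - b *\<^sub>R integral {real m..t} (\<lambda>s. center_of_mass Z s w)"
proof -
  have "AE w in M. \<forall>m. \<forall>i\<in>{1..2 ^ m}. continuous_on {real m..<real m + 1} (\<lambda>t. Z t i w)"
    using Z_continuous by (simp add: AE_all_countable AE_ball_countable)
  moreover have "AE w in M. \<forall>m. \<forall>i\<in>{1..2 ^ m}. \<forall>t\<in>{real m..<real m + 1}.
      Z t i w = Z (real m) i w + (W m i t w - W m i (real m) w)
        + integral {real m..t} (\<lambda>s. interaction_drift b \<gamma> m (\<lambda>j. Z s j w) i)"
    using SDE by (simp add: AE_all_countable AE_ball_countable)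
  ultimately show ?thesis
  proof eventually_elim
    case (elim w)
    show ?case
    proof (intro allI ballI)
      fix m :: nat and t :: real assume t: "t \<in> {real m..<real m + 1}"
      let ?I = "{1..(2::nat) ^ m}"
      have cont: "continuous_on {real m..t} (\<lambda>s. Z s i w)" if "i \<in> ?I" for i
        by (rule continuous_on_subset[of "{real m..<real m + 1}"]) (use elim(1) that t in auto)
      have "(\<Sum>i\<in>?I. integral {real m..t} (\<lambda>s. interaction_drift b \<gamma> m (\<lambda>j. Z s j w) i))
          = integral {real m..t} (\<lambda>s. \<Sum>i\<in>?I. interaction_drift b \<gamma> m (\<lambda>j. Z s j w) i)"
        unfolding interaction_drift_def
        by (intro integral_sum[symmetric] integrable_continuous_interval continuous_intros cont) auto
      also have "\<dots> = integral {real m..t} (\<lambda>s. - (b * 2 ^ m) *\<^sub>R center_of_mass Z s w)"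
        unfolding sum_interaction_drift
        by (intro integral_cong) (use t in \<open>simp add: center_of_mass_eq[where m = m]\<close>)
      also have "\<dots> = - (b * 2 ^ m) *\<^sub>R integral {real m..t} (\<lambda>s. center_of_mass Z s w)"
        by (rule integral_cmul)
      finally have drift: "(\<Sum>i\<in>?I. integral {real m..t} (\<lambda>s. interaction_drift b \<gamma> m (\<lambda>j. Z s j w) i))
          = - (b * 2 ^ m) *\<^sub>R integral {real m..t} (\<lambda>s. center_of_mass Z s w)" .
      have "(\<Sum>i\<in>?I. Z t i w) = (\<Sum>i\<in>?I. Z (real m) i w + (W m i t w - W m i (real m) w)
          + integral {real m..t} (\<lambda>s. interaction_drift b \<gamma> m (\<lambda>j. Z s j w) i))"
        by (intro sum.cong refl) (use elim(2) t in blast)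
      also have "\<dots> = (\<Sum>i\<in>?I. Z (real m) i w) + ((\<Sum>i\<in>?I. W m i t w) - (\<Sum>i\<in>?I. W m i (real m) w))
          - (b * 2 ^ m) *\<^sub>R integral {real m..t} (\<lambda>s. center_of_mass Z s w)"
        by (simp only: sum.distrib sum_subtractf drift) simp
      finally have "(1 / 2 ^ m) *\<^sub>R (\<Sum>i\<in>?I. Z t i w) = (1 / 2 ^ m) *\<^sub>R \<dots>"
        by simp
      then show "center_of_mass Z t w = center_of_mass Z (real m) w
          + (mean_noise W m t w - mean_noise W m (real m) w)
          - b *\<^sub>R integral {real m..t} (\<lambda>s. center_of_mass Z s w)"
        using t by (simp add: center_of_mass_eq[where m = m] mean_noise_def scaleR_add_right scaleR_diff_right)
    qed
  qed
qed

text \<open>Each particle of the old generation is the parent of exactly two new ones. So the average of the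
  parents' positions over the doubled index set is the old center of mass, and the branching causes
  no jump.\<close>

lemma center_of_mass_left_continuous:
  "AE w in M. \<forall>m. ((\<lambda>t. center_of_mass Z t w) \<longlongrightarrow> center_of_mass Z (real (Suc m)) w)
    (at_left (real (Suc m)))"
proof -
  have "AE w in M. \<forall>m. (\<forall>i\<in>{1..2 ^ Suc m}. parent (Suc m) i w \<in> {1..2 ^ m}) \<and>
      (\<forall>j\<in>{1..2 ^ m}. card {i \<in> {1..2 ^ Suc m}. parent (Suc m) i w = j} = 2)"
    using two_offspring[of "Suc _"] by (simp add: AE_all_countable)
  moreover have "AE w in M. \<forall>m. \<forall>i\<in>{1..2 ^ Suc m}.
      ((\<lambda>t. Z t (parent (Suc m) i w) w) \<longlongrightarrow> Z (real (Suc m)) i w) (at_left (real (Suc m)))"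
    using born_at_parent[of "Suc _"] by (simp add: AE_all_countable AE_ball_countable del: of_nat_Suc power_Suc)
  ultimately show ?thesis
  proof eventually_elim
    case (elim w)
    show ?case
    proof
      fix m
      let ?p = "\<lambda>i. parent (Suc m) i w"
      have parents: "?p ` {1..2 ^ Suc m} \<subseteq> {1..2 ^ m}"
        using elim(1) by blast
      have siblings: "card {i \<in> {1..2 ^ Suc m}. ?p i = j} = 2" if "j \<in> {1..2 ^ m}" for j
        using elim(1) that by blast
      have "((\<lambda>t. (1 / 2 ^ Suc m) *\<^sub>R (\<Sum>i\<in>{1..2 ^ Suc m}. Z t (?p i) w)) \<longlongrightarrow>
          (1 / 2 ^ Suc m) *\<^sub>R (\<Sum>i\<in>{1..2 ^ Suc m}. Z (real (Suc m)) i w)) (at_left (real (Suc m)))"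
        by (intro tendsto_intros) (use elim(2) in blast)
      then have "((\<lambda>t. (1 / 2 ^ Suc m) *\<^sub>R (\<Sum>i\<in>{1..2 ^ Suc m}. Z t (?p i) w)) \<longlongrightarrow>
          center_of_mass Z (real (Suc m)) w) (at_left (real (Suc m)))"
        by (subst center_of_mass_eq[where m = "Suc m"]) auto
      moreover have "eventually (\<lambda>t. t \<in> {real m<..<real (Suc m)}) (at_left (real (Suc m)))"
        by (rule eventually_at_left_real) simp
      then have "\<forall>\<^sub>F t in at_left (real (Suc m)).
        (1 / 2 ^ Suc m) *\<^sub>R (\<Sum>i\<in>{1..2 ^ Suc m}. Z t (?p i) w) = center_of_mass Z t w"
      proof eventually_elim
        case (elim t)
        have "(\<Sum>i\<in>{1..2 ^ Suc m}. Z t (?p i) w)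
            = (\<Sum>j\<in>{1..2 ^ m}. \<Sum>i | i \<in> {1..2 ^ Suc m} \<and> ?p i = j. Z t (?p i) w)"
          by (rule sum.group[symmetric, OF _ _ parents]) simp_all
        also have "\<dots> = (\<Sum>j\<in>{1..2 ^ m}. 2 *\<^sub>R Z t j w)"
        proof (rule sum.cong)
          fix j :: nat assume j: "j \<in> {1..2 ^ m}"
          have "(\<Sum>i | i \<in> {1..2 ^ Suc m} \<and> ?p i = j. Z t (?p i) w)
              = (\<Sum>i | i \<in> {1..2 ^ Suc m} \<and> ?p i = j. Z t j w)"
            by (rule sum.cong) auto
          also have "\<dots> = 2 *\<^sub>R Z t j w"
            by (simp only: sum_constant_scaleR siblings[OF j]) simp
          finally show "(\<Sum>i | i \<in> {1..2 ^ Suc m} \<and> ?p i = j. Z t (?p i) w) = 2 *\<^sub>R Z t j w" .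
        qed simp
        finally show ?case
          using elim by (simp add: center_of_mass_eq[where m = m] scaleR_sum_right[symmetric])
      qed
      ultimately show "((\<lambda>t. center_of_mass Z t w) \<longlongrightarrow> center_of_mass Z (real (Suc m)) w)
          (at_left (real (Suc m)))"
        by (rule Lim_transform_eventually)
    qed
  qed
qed

end

section \<open>Convergence of the center of mass\<close>

theorem theorem2p1:
  fixes M :: "'w measure"
    and b \<gamma> :: real
    and Z :: "real \<Rightarrow> nat \<Rightarrow> 'w \<Rightarrow> real ^ 'd"
    and W :: "nat \<Rightarrow> nat \<Rightarrow> real \<Rightarrow> 'w \<Rightarrow> real ^ 'd"
    and parent :: "nat \<Rightarrow> nat \<Rightarrow> 'w \<Rightarrow> nat"
  assumes "\<gamma> \<noteq> 0"
    and "interacting_branching_diffusion M b \<gamma> Z W parent"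
    and "b > 0"
  shows "AE w in M. ((\<lambda>t. center_of_mass Z t w) \<longlongrightarrow> 0) at_top"
proof -
  interpret interacting_branching_diffusion M b \<gamma> Z W parent by fact
  show ?thesis
    using center_of_mass_continuous center_of_mass_left_continuous center_of_mass_equation
      mean_noise_decay
  proof eventually_elim
    case (elim w)
    then obtain A where A: "\<And>m t. t \<in> {real m..<real m + 1} \<Longrightarrow>
        norm (mean_noise W m t w - mean_noise W m (real m) w) \<le> A * (9 / 10) ^ m"
      by blast
    show ?case
    proof (rule perturbed_linear_ode_tendsto_0[OF \<open>b > 0\<close>])
      show "summable (\<lambda>m. A * (9 / 10 :: real) ^ m)"
        by (intro summable_mult summable_geometric) simp
    qed (use elim A in blast)+
  qed
qed

end
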